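(* Consider a quadcopter with equations of motion $$\dot b=Rv,\qquad \dot R=R\hat\Omega,\qquad m\dot v=mv\times\Omega+f_1+f_2+f_3,\qquad J\dot\Omega=J\Omega\times\Omega+\tau_f+\tau_1+\tau_2,$$ with forces and torques as defined in the context. In the coordinates $(b_1,b_2,b_3,\phi,\theta,\psi,v_1,v_2,v_3,\Omega_1,\Omega_2,\Omega_3)$ described in the context, with $(\phi,\theta,\psi)\in(-\pi,\pi)\times(-\pi/2,\pi/2)\times(-\pi,\pi)$, these equations take the form \begin{align*} \dot b_1&=v_1C_\psi C_\theta+v_2(C_\psi S_\theta S_\phi-S_\psi C_\phi)+v_3(C_\psi S_\theta C_\phi+S_\psi S_\phi)\\ \dot b_2&=v_1S_\psi C_\theta+v_2(S_\psi S_\theta S_\phi+C_\psi C_\phi)+v_3(S_\psi S_\theta C_\phi-C_\psi S_\phi)\\ \dot b_3&=-v_1S_\theta+v_2C_\theta S_\phi+v_3C_\theta C_\phi\\ \dot\phi&=\Omega_1+\Omega_2S_\phi T_\theta+\Omega_3C_\phi T_\theta\\ \dot\theta&=\Omega_2C_\phi-\Omega_3S_\phi\\ \dot\psi&=\Omega_2\frac{S_\phi}{C_\theta}+\Omega_3\frac{C_\phi}{C_\theta}\\ \dot v_1&=v_2\Omega_3-v_3\Omega_2-\tfrac1m v_1|v_1|C_{D_1}+gS_\theta\\ \dot v_2&=v_3\Omega_1-v_1\Omega_3-\tfrac1m v_2|v_2|C_{D_2}-gC_\theta S_\phi\\ \dot v_3&=v_1\Omega_2-v_2\Omega_1+\tfrac1m\Big(\sum_{i=1}^4t_i-v_3|v_3|C_{D_3}\Big)-gC_\theta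 C_\phi\\ \dot\Omega_1&=\tfrac1{J_1}\Big[(J_2-J_3)\Omega_2\Omega_3+\bar J_r\sum_{i=1}^4(-1)^{i+1}\Omega_2\omega_i+K_rd(\omega_3^2-\omega_1^2)-\Omega_1|\Omega_1|C_{\tau_1}\Big]\\ \dot\Omega_2&=\tfrac1{J_2}\Big[(J_3-J_1)\Omega_1\Omega_3-\bar J_r\sum_{i=1}^4(-1)^{i+1}\Omega_1\omega_i+K_rd(\omega_4^2-\omega_2^2)-\Omega_2|\Omega_2|C_{\tau_2}\Big]\\ \dot\Omega_3&=\tfrac1{J_3}\Big[(J_1-J_2)\Omega_1\Omega_2+K_d\sum_{i=1}^4(-1)^{i+1}\omega_i^2-\Omega_3|\Omega_3|C_{\tau_3}\Big]. \end{align*}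
   Context: Here $b=(b_1,b_2,b_3)\in\mathbb R^3$ is the position of the center of mass in an inertial frame, $R\in SO(3)$ the orientation, $v=(v_1,v_2,v_3)$ and $\Omega=(\Omega_1,\Omega_2,\Omega_3)$ the translational and angular velocities in the body frame, and $\omega_1,\dots,\omega_4$ the rotor speeds. The hat map is defined by $\hat y z=y\times z$. Notation: $C_x=\cos x$, $S_x=\sin x$, $T_x=\tan x$. Coordinates on orientations: $R=R_{3,\psi}R_{2,\theta}R_{1,\phi}$, where $$R_{1,\phi}=\begin{pmatrix}1&0&0\\0&C_\phi&-S_\phi\\0&S_\phi&C_\phi\end{pmatrix},\quad R_{2,\theta}=\begin{pmatrix}C_\theta&0&S_\theta\\0&1&0\\-S_\theta&0&C_\theta\end{pmatrix},\quad R_{3,\psi}=\begin{pmatrix}C_\psi&-S_\psi&0\\S_\psi&C_\psi&0\\0&0&1\end{pmatrix}$$ ($\phi,\theta,\psi$ are roll, pitch and yaw). Constants: mass $m>0$; inertia tensor $J=\mathrm{diag}(J_1,J_2,J_3)$ with $J_k>0$; gravitational constant $g>0$; thrust coefficient $K_r>0$; propeller drag coefficient $K_d>0$; distance $d>0$ from the center of mass to each rotor axis; drag vectors $C_D=(C_{D_1},C_{D_2},C_{D_3})^t$ and $C_\tau=(C_{\tau_1},C_{\tau_2},C_{\tau_3})^t$; rotor inertia $J_r=\mathrm{diag}(0,0,\bar J_r)$. The thrust of rotor $i$ is $t_i=K_r\omega_i^2$. Let $e_3=(0,0,1)^t$. The forces and torques, in the body frame, are - $f_1=-\mathrm{diag}(v_1|v_1|,v_2|v_2|,v_3|v_3|)\,C_D$;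 - $f_2=-mgR^te_3$; - $f_3=\sum_{i=1}^4t_i\,e_3$; - $\tau_f=\big(K_rd(\omega_3^2-\omega_1^2),\;K_rd(\omega_4^2-\omega_2^2),\;K_d\sum_{i=1}^4(-1)^{i+1}\omega_i^2\big)^t$; - $\tau_1=-\mathrm{diag}(\Omega_1|\Omega_1|,\Omega_2|\Omega_2|,\Omega_3|\Omega_3|)\,C_\tau$; - $\tau_2=\sum_{i=1}^4\Omega\times(-1)^{i+1}J_r(0,0,\omega_i)^t$. "Take the form" means: a differentiable curve $(b,R,v,\Omega)$ whose orientation is given by differentiable angles $(\phi,\theta,\psi)$ in the stated range satisfies the original equations if and only if its coordinates satisfy the displayed scalar equations. *)

theory Defs
  imports "HOL-Analysis.Analysis"
begin

unbundle cross3_syntax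

text \<open>The time derivative of a curve defined on a time interval \<open>I\<close>; at an end point of \<open>I\<close>
  that belongs to \<open>I\<close> it is the one-sided derivative. It is meaningful only where the curve is
  differentiable.\<close>

abbreviation dot :: "real set \<Rightarrow> (real \<Rightarrow> 'a::real_normed_vector) \<Rightarrow> real \<Rightarrow> 'a" where
  "dot I f t \<equiv> vector_derivative f (at t within I)"

definition diag :: "real^'n \<Rightarrow> real^'n^'n" where
  "diag x = (\<chi> i j. if i = j then x $ i else 0)"

definition hat :: "real^3 \<Rightarrow> real^3^3" where
  "hat y = matrix (\<lambda>z. y \<times> z)"

lemma hat_mult_vec: "hat y *v z = y \<times> z"
proof -
  have "linear (\<lambda>z. y \<times> z)"
    by (rule linearI) (simp_all add: cross_add_right cross_mult_right)
  then show ?thesis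
    by (simp add: hat_def)
qed

definition rot1 :: "real \<Rightarrow> real^3^3" where
  "rot1 \<phi> = vector
    [vector [1, 0, 0],
     vector [0, cos \<phi>, - sin \<phi>],
     vector [0, sin \<phi>, cos \<phi>]]"

definition rot2 :: "real \<Rightarrow> real^3^3" where
  "rot2 \<theta> = vector
    [vector [cos \<theta>, 0, sin \<theta>],
     vector [0, 1, 0],
     vector [- sin \<theta>, 0, cos \<theta>]]"

definition rot3 :: "real \<Rightarrow> real^3^3" where
  "rot3 \<psi> = vector
    [vector [cos \<psi>, - sin \<psi>, 0],
     vector [sin \<psi>, cos \<psi>, 0],
     vector [0, 0, 1]]"

abbreviation (input) e3 :: "real^3" where
  "e3 \<equiv> vector [0, 0, 1]"

text \<open>Rotor speeds are a family \<open>w\<close> indexed by natural numbers, of which only the entries with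
  indices 1 to 4 are used.\<close>

definition thrust :: "real \<Rightarrow> (nat \<Rightarrow> real) \<Rightarrow> nat \<Rightarrow> real" where
  "thrust K\<^sub>r w i = K\<^sub>r * (w i)\<^sup>2"

definition force1 :: "real^3 \<Rightarrow> real^3 \<Rightarrow> real^3" where
  "force1 C\<^sub>D v =
    - (diag (vector [v $ 1 * \<bar>v $ 1\<bar>, v $ 2 * \<bar>v $ 2\<bar>, v $ 3 * \<bar>v $ 3\<bar>]) *v C\<^sub>D)"

definition force2 :: "real \<Rightarrow> real \<Rightarrow> real^3^3 \<Rightarrow> real^3" where
  "force2 m g R = - ((m * g) *\<^sub>R (transpose R *v e3))"

definition force3 :: "real \<Rightarrow> (nat \<Rightarrow> real) \<Rightarrow> real^3" where
  "force3 K\<^sub>r w = (\<Sum>i=1..4. thrust K\<^sub>r w i) *\<^sub>R e3"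

definition torque_f :: "real \<Rightarrow> real \<Rightarrow> real \<Rightarrow> (nat \<Rightarrow> real) \<Rightarrow> real^3" where
  "torque_f K\<^sub>r K\<^sub>d d w = vector
    [K\<^sub>r * d * ((w 3)\<^sup>2 - (w 1)\<^sup>2),
     K\<^sub>r * d * ((w 4)\<^sup>2 - (w 2)\<^sup>2),
     K\<^sub>d * (\<Sum>i=1..4. (-1) ^ (i + 1) * (w i)\<^sup>2)]"

definition torque1 :: "real^3 \<Rightarrow> real^3 \<Rightarrow> real^3" where
  "torque1 C\<^sub>\<tau> \<Omega> =
    - (diag (vector [\<Omega> $ 1 * \<bar>\<Omega> $ 1\<bar>, \<Omega> $ 2 * \<bar>\<Omega> $ 2\<bar>, \<Omega> $ 3 * \<bar>\<Omega> $ 3\<bar>]) *v C\<^sub>\<tau>)"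

text \<open>The scalar argument \<open>Jr\<close> is the only nonzero entry of the rotor inertia tensor.\<close>

definition torque2 :: "real \<Rightarrow> real^3 \<Rightarrow> (nat \<Rightarrow> real) \<Rightarrow> real^3" where
  "torque2 Jr \<Omega> w =
    (\<Sum>i=1..4. \<Omega> \<times> ((-1) ^ (i + 1) *\<^sub>R (diag (vector [0, 0, Jr]) *v vector [0, 0, w i])))"

end

theory Submission
  imports Defs
begin

text \<open>Differentiating \<open>R = rot3 \<psi> ** rot2 \<theta> ** rot1 \<phi>\<close> gives \<open>R' = R ** hat W\<close>, where the body
  rate \<open>W\<close> is linear in the angle velocities. As \<open>R\<close> is invertible and the hat map injective, the
  attitude equation says \<open>W = \<Omega>\<close>, and this linear system is solvable for the angle velocities
  because \<open>cos \<theta> > 0\<close>. The other equations are read off in components.\<close>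

section \<open>Components, and derivatives within an interval\<close>

lemma has_vector_derivative_nth:
  assumes "(f has_vector_derivative f') F"
  shows "((\<lambda>x. f x $ i) has_vector_derivative f' $ i) F"
  using bounded_linear.has_vector_derivative[OF bounded_linear_vec_nth assms] .

text \<open>Since \<open>dot\<close> chooses some derivative, it can be evaluated only where a
  derivative exists and is unique. Differentiability gives existence, and the nontrivial filter
  gives uniqueness.\<close>

lemma vector_derivative_nth:
  fixes f :: "real \<Rightarrow> 'a::real_normed_vector^'n"
  assumes "f differentiable at t within I" and "at t within I \<noteq> bot"
  shows "dot I (\<lambda>s. f s $ i) t = dot I f t $ i"
  using assms(2) has_vector_derivative_nth[OF iffD1[OF vector_derivative_works assms(1)]]
  by (rule vector_derivative_within)

lemma diag_mult_nth: "(diag x *v y) $ i = x $ i * y $ i"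
  by (simp add: diag_def matrix_vector_mult_def if_distrib[where f = "\<lambda>z. z * _"] cong: if_cong)

text \<open>A connected set with more than one point has no isolated points, and a nonempty interior
  rules out a singleton. Thus derivatives within \<open>I\<close> are unique, also at end points
  belonging to \<open>I\<close>.\<close>

lemma at_within_interval_neq_bot:
  fixes I :: "real set"
  assumes "is_interval I" "interior I \<noteq> {}" "t \<in> I"
  shows "at t within I \<noteq> bot"
proof -
  have "I \<noteq> {t}"
    using assms(2) by auto
  with assms have "t islimpt I"
    by (intro connected_imp_perfect) (auto simp: is_interval_connected)
  then show ?thesis
    by (simp add: trivial_limit_within)
qed

section \<open>The hat map, the rotation matrix and its derivative\<close>

lemma hat_eq: "hat y = vector
    [vector [0, - y $ 3, y $ 2],
     vector [y $ 3, 0, - y $ 1],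
     vector [- y $ 2, y $ 1, 0]]"
  by (simp add: hat_def matrix_def vec_eq_iff forall_3 cross3_def axis_def)

lemma hat_inject: "hat x = hat y \<longleftrightarrow> x = y"
  by (auto simp: hat_eq vec_eq_iff forall_3)

lemma rot_product_eq:
  "rot3 \<psi> ** rot2 \<theta> ** rot1 \<phi> = vector
    [vector [cos \<psi> * cos \<theta>,
       cos \<psi> * sin \<theta> * sin \<phi> - sin \<psi> * cos \<phi>,
       cos \<psi> * sin \<theta> * cos \<phi> + sin \<psi> * sin \<phi>],
     vector [sin \<psi> * cos \<theta>,
       sin \<psi> * sin \<theta> * sin \<phi> + cos \<psi> * cos \<phi>,
       sin \<psi> * sin \<theta> * cos \<phi> - cos \<psi> * sin \<phi>],
     vector [- sin \<theta>, cos \<theta> * sin \<phi>, cos \<theta> * cos \<phi>]]"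
  by (simp add: rot1_def rot2_def rot3_def matrix_matrix_mult_def vec_eq_iff forall_3 sum_3)

text \<open>The angular velocity in the body frame: the sum of \<open>\<phi>'\<close>,
  \<open>\<theta>'\<close> and \<open>\<psi>'\<close> times the roll, pitch and yaw axes as seen
  from the body, which are the first unit vector, the second row of \<open>rot1 \<phi>\<close> and
  the third row of \<open>rot2 \<theta> ** rot1 \<phi>\<close>.\<close>

definition body_rate :: "real \<Rightarrow> real \<Rightarrow> real \<Rightarrow> real \<Rightarrow> real \<Rightarrow> real^3" where
  "body_rate \<phi> \<theta> \<phi>' \<theta>' \<psi>' = vector
    [\<phi>' - \<psi>' * sin \<theta>,
     \<theta>' * cos \<phi> + \<psi>' * cos \<theta> * sin \<phi>,
     \<psi>' * cos \<theta> * cos \<phi> - \<theta>' * sin \<phi>]"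

text \<open>As a linear system in the angle velocities this has determinant
  \<open>cos \<theta>\<close>. Rotating the last two components by \<open>\<phi>\<close> isolates
  \<open>\<theta>'\<close> and \<open>\<psi>' * cos \<theta>\<close>; the first component then
  determines \<open>\<phi>'\<close>.\<close>

lemma body_rate_eq_iff:
  assumes "cos \<theta> \<noteq> 0"
  shows "body_rate \<phi> \<theta> \<phi>' \<theta>' \<psi>' = \<Omega> \<longleftrightarrow>
    \<phi>' = \<Omega> $ 1 + \<Omega> $ 2 * sin \<phi> * tan \<theta> + \<Omega> $ 3 * cos \<phi> * tan \<theta> \<and>
    \<theta>' = \<Omega> $ 2 * cos \<phi> - \<Omega> $ 3 * sin \<phi> \<and>
    \<psi>' = \<Omega> $ 2 * (sin \<phi> / cos \<theta>) + \<Omega> $ 3 * (cos \<phi> / cos \<theta>)"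
    (is "?L \<longleftrightarrow> ?R")
proof -
  have sc: "sin \<phi> * sin \<phi> + cos \<phi> * cos \<phi> = 1"
    using sin_cos_squared_add3 by (simp add: add.commute)
  show ?thesis
  proof
    assume ?L
    then have \<Omega>: "\<Omega> $ 1 = \<phi>' - \<psi>' * sin \<theta>" "\<Omega> $ 2 = \<theta>' * cos \<phi> + \<psi>' * cos \<theta> * sin \<phi>"
      "\<Omega> $ 3 = \<psi>' * cos \<theta> * cos \<phi> - \<theta>' * sin \<phi>"
      by (auto simp: body_rate_def)
    \<comment> \<open>This combination cancels \<open>\<psi>'\<close> and the next one cancels
      \<open>\<theta>'\<close>; what remains carries the factor
      \<open>sin \<phi> * sin \<phi> + cos \<phi> * cos \<phi>\<close>.\<close>
    have 2: "\<Omega> $ 2 * cos \<phi> - \<Omega> $ 3 * sin \<phi> = \<theta>'"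
      unfolding \<Omega> using sc by algebra
    have 3: "\<Omega> $ 2 * sin \<phi> + \<Omega> $ 3 * cos \<phi> = \<psi>' * cos \<theta>"
      unfolding \<Omega> using sc by algebra
    have "\<Omega> $ 2 * sin \<phi> * tan \<theta> + \<Omega> $ 3 * cos \<phi> * tan \<theta> = (\<Omega> $ 2 * sin \<phi> + \<Omega> $ 3 * cos \<phi>) * tan \<theta>"
      by (simp add: algebra_simps)
    also have "\<dots> = \<psi>' * sin \<theta>"
      unfolding 3 using assms by (simp add: tan_def)
    finally show ?R
      using 2 3 assms \<Omega>(1) by (simp add: field_simps)
  next
    assume R: ?R
    have p: "\<psi>' * cos \<theta> = \<Omega> $ 2 * sin \<phi> + \<Omega> $ 3 * cos \<phi>"
      using R assms by (simp add: field_simps)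
    \<comment> \<open>The first component involves \<open>\<psi>' * sin \<theta>\<close>, whereas
      \<open>p\<close> gives \<open>\<psi>' * cos \<theta>\<close>; the tangent converts one into
      the other.\<close>
    have "\<psi>' * sin \<theta> = \<psi>' * cos \<theta> * tan \<theta>"
      using assms by (simp add: tan_def)
    then have "\<psi>' * sin \<theta> = \<Omega> $ 2 * sin \<phi> * tan \<theta> + \<Omega> $ 3 * cos \<phi> * tan \<theta>"
      by (simp add: p algebra_simps)
    then have 1: "\<phi>' - \<psi>' * sin \<theta> = \<Omega> $ 1"
      using R by simp
    have t: "\<theta>' = \<Omega> $ 2 * cos \<phi> - \<Omega> $ 3 * sin \<phi>"
      using R by simp
    have 2: "\<theta>' * cos \<phi> + \<psi>' * cos \<theta> * sin \<phi> = \<Omega> $ 2"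
      unfolding p t using sc by algebra
    have 3: "\<psi>' * cos \<theta> * cos \<phi> - \<theta>' * sin \<phi> = \<Omega> $ 3"
      unfolding p t using sc by algebra
    show ?L
      by (simp add: body_rate_def vec_eq_iff forall_3 1 2 3)
  qed
qed

text \<open>Each entry of the product is a trigonometric polynomial in the angles. The product rule
  yields its derivative, and uniqueness of derivatives identifies this with the entry of
  \<open>dot I R t\<close>.\<close>

lemma vector_derivative_rot_product:
  assumes R: "R differentiable at t within I" and nt: "at t within I \<noteq> bot" and t: "t \<in> I"
    and eq: "\<And>s. s \<in> I \<Longrightarrow> R s = rot3 (\<psi> s) ** rot2 (\<theta> s) ** rot1 (\<phi> s)"
    and \<phi>: "(\<phi> has_real_derivative \<phi>') (at t within I)"
    and \<theta>: "(\<theta> has_real_derivative \<theta>') (at t within I)"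
    and \<psi>: "(\<psi> has_real_derivative \<psi>') (at t within I)"
  shows "dot I R t = R t ** hat (body_rate (\<phi> t) (\<theta> t) \<phi>' \<theta>' \<psi>')"
proof -
  \<comment> \<open>It suffices to differentiate the entries of the product: \<open>R\<close> agrees
    with it on all of \<open>I\<close>, and the derivatives are taken within
    \<open>I\<close>.\<close>
  have entry: "dot I R t $ i $ j = D"
    if "((\<lambda>s. (rot3 (\<psi> s) ** rot2 (\<theta> s) ** rot1 (\<phi> s)) $ i $ j) has_real_derivative D)
      (at t within I)" for i j D
  proof -
    have "((\<lambda>s. R s $ i $ j) has_vector_derivative dot I R t $ i $ j) (at t within I)"
      using R by (intro has_vector_derivative_nth) (simp add: vector_derivative_works)
    moreover have "((\<lambda>s. R s $ i $ j) has_vector_derivative D) (at t within I)"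
      using has_vector_derivative_transform[OF t _ that[unfolded has_real_derivative_iff_has_vector_derivative]]
      by (simp add: eq)
    ultimately show ?thesis
      using vector_derivative_unique_within[OF nt] by blast
  qed
  \<comment> \<open>Pythagoras is oriented so as to eliminate squares of sines; the second form
    catches such a square at the head of a right-nested product. Together they bring both sides of
    each entry to a common normal form.\<close>
  have sin_sin: "sin x * sin x = 1 - cos x * cos x" for x :: real
    using sin_cos_squared_add3[of x] by linarith
  have sin_sin_mult: "sin x * (sin x * y) = y - cos x * (cos x * y)" for x y :: real
    unfolding mult.assoc[symmetric] sin_sin by (simp add: algebra_simps)
  show ?thesis
    unfolding vec_eq_iff forall_3
    \<comment> \<open>For each of the nine entries, \<open>D\<close> becomes the claimed entry of
      \<open>R t ** hat (...)\<close>; the differentiation rules then leave an identity in sines and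
      cosines.\<close>
    by (intro conjI; rule entry; unfold rot_product_eq eq[OF t];
        simp add: hat_eq body_rate_def matrix_matrix_mult_def sum_3;
        (rule derivative_eq_intros \<phi> \<theta> \<psi> refl)+; simp add: algebra_simps sin_sin sin_sin_mult)
qed

section \<open>The equations of motion in scalar form\<close>

lemma translation_kinematics_iff:
  "x = (rot3 \<psi> ** rot2 \<theta> ** rot1 \<phi>) *v v \<longleftrightarrow>
    x $ 1 = v $ 1 * (cos \<psi> * cos \<theta>)
      + v $ 2 * (cos \<psi> * sin \<theta> * sin \<phi> - sin \<psi> * cos \<phi>)
      + v $ 3 * (cos \<psi> * sin \<theta> * cos \<phi> + sin \<psi> * sin \<phi>) \<and>
    x $ 2 = v $ 1 * (sin \<psi> * cos \<theta>)
      + v $ 2 * (sin \<psi> * sin \<theta> * sin \<phi> + cos \<psi> * cos \<phi>)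
      + v $ 3 * (sin \<psi> * sin \<theta> * cos \<phi> - cos \<psi> * sin \<phi>) \<and>
    x $ 3 = - v $ 1 * sin \<theta> + v $ 2 * (cos \<theta> * sin \<phi>) + v $ 3 * (cos \<theta> * cos \<phi>)"
  unfolding rot_product_eq by (simp add: matrix_vector_mult_def vec_eq_iff forall_3 sum_3 algebra_simps)

text \<open>Orthogonality makes \<open>transpose R\<close> a left inverse, so \<open>R\<close>
  cancels. Injectivity of the hat map leaves an equation between two vectors, which is solved for
  the angle velocities.\<close>

lemma attitude_kinematics_iff:
  assumes "rotation_matrix R" and "cos \<theta> \<noteq> 0"
  shows "R ** hat (body_rate \<phi> \<theta> \<phi>' \<theta>' \<psi>') = R ** hat \<Omega> \<longleftrightarrow>
    \<phi>' = \<Omega> $ 1 + \<Omega> $ 2 * sin \<phi> * tan \<theta> + \<Omega> $ 3 * cos \<phi> * tan \<theta> \<and>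
    \<theta>' = \<Omega> $ 2 * cos \<phi> - \<Omega> $ 3 * sin \<phi> \<and>
    \<psi>' = \<Omega> $ 2 * (sin \<phi> / cos \<theta>) + \<Omega> $ 3 * (cos \<phi> / cos \<theta>)"
proof -
  have "transpose R ** R = mat 1"
    using assms(1) by (simp add: rotation_matrix_def orthogonal_matrix_def)
  then have "R ** A = R ** B \<longleftrightarrow> A = B" for A B :: "real^3^3"
    by (metis matrix_mul_assoc matrix_mul_lid)
  then show ?thesis
    unfolding body_rate_eq_iff[OF assms(2), symmetric] by (simp add: hat_inject)
qed

lemma translation_dynamics_iff:
  fixes v \<Omega> x C\<^sub>D :: "real^3"
  assumes "m > 0"
  shows "m *\<^sub>R x = (m *\<^sub>R v) \<times> \<Omega> + force1 C\<^sub>D v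
      + force2 m g (rot3 \<psi> ** rot2 \<theta> ** rot1 \<phi>) + force3 K\<^sub>r w \<longleftrightarrow>
    x $ 1 = v $ 2 * \<Omega> $ 3 - v $ 3 * \<Omega> $ 2
      - 1 / m * v $ 1 * \<bar>v $ 1\<bar> * C\<^sub>D $ 1 + g * sin \<theta> \<and>
    x $ 2 = v $ 3 * \<Omega> $ 1 - v $ 1 * \<Omega> $ 3
      - 1 / m * v $ 2 * \<bar>v $ 2\<bar> * C\<^sub>D $ 2 - g * cos \<theta> * sin \<phi> \<and>
    x $ 3 = v $ 1 * \<Omega> $ 2 - v $ 2 * \<Omega> $ 1
      + 1 / m * ((\<Sum>i=1..4. thrust K\<^sub>r w i) - v $ 3 * \<bar>v $ 3\<bar> * C\<^sub>D $ 3)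
      - g * cos \<theta> * cos \<phi>"
proof -
  \<comment> \<open>The vertical seen from the body is the third row of the rotation matrix, so yaw
    disappears from the gravity term.\<close>
  have gravity: "transpose (rot3 \<psi> ** rot2 \<theta> ** rot1 \<phi>) *v e3 =
      vector [- sin \<theta>, cos \<theta> * sin \<phi>, cos \<theta> * cos \<phi>]"
    unfolding rot_product_eq
    by (simp add: vec_eq_iff forall_3 matrix_vector_mult_def sum_3 transpose_def)
  have div: "m * y = z \<longleftrightarrow> y = 1 / m * z" for y z
    using assms by (auto simp: field_simps)
  show ?thesis
    unfolding force1_def force2_def force3_def gravity vec_eq_iff forall_3
      vector_scaleR_component real_scaleR_def div
    using assms by (simp add: diag_mult_nth cross3_def field_simps)
qed

text \<open>As the inertia tensor is diagonal with positive entries, each component can be solved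
  for its own angular acceleration.\<close>

lemma rotation_dynamics_iff:
  fixes \<Omega> x J C\<^sub>\<tau> :: "real^3"
  assumes "\<And>k. J $ k > 0"
  shows "diag J *v x = (diag J *v \<Omega>) \<times> \<Omega> + torque_f K\<^sub>r K\<^sub>d d w + torque1 C\<^sub>\<tau> \<Omega>
      + torque2 Jr \<Omega> w \<longleftrightarrow>
    x $ 1 = 1 / J $ 1 * ((J $ 2 - J $ 3) * \<Omega> $ 2 * \<Omega> $ 3
      + Jr * (\<Sum>i=1..4. (-1) ^ (i + 1) * \<Omega> $ 2 * w i)
      + K\<^sub>r * d * ((w 3)\<^sup>2 - (w 1)\<^sup>2) - \<Omega> $ 1 * \<bar>\<Omega> $ 1\<bar> * C\<^sub>\<tau> $ 1) \<and>
    x $ 2 = 1 / J $ 2 * ((J $ 3 - J $ 1) * \<Omega> $ 1 * \<Omega> $ 3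
      - Jr * (\<Sum>i=1..4. (-1) ^ (i + 1) * \<Omega> $ 1 * w i)
      + K\<^sub>r * d * ((w 4)\<^sup>2 - (w 2)\<^sup>2) - \<Omega> $ 2 * \<bar>\<Omega> $ 2\<bar> * C\<^sub>\<tau> $ 2) \<and>
    x $ 3 = 1 / J $ 3 * ((J $ 1 - J $ 2) * \<Omega> $ 1 * \<Omega> $ 2
      + K\<^sub>d * (\<Sum>i=1..4. (-1) ^ (i + 1) * (w i)\<^sup>2) - \<Omega> $ 3 * \<bar>\<Omega> $ 3\<bar> * C\<^sub>\<tau> $ 3)"
proof -
  have div: "J $ k * y = z \<longleftrightarrow> y = 1 / J $ k * z" for k y z
    using assms[of k] by (auto simp: field_simps)
  \<comment> \<open>Every rotor's angular momentum is a multiple of the third unit vector, whose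
    cross product with \<open>\<Omega>\<close> on the left is
    \<open>(\<Omega> $ 2, - \<Omega> $ 1, 0)\<close>. Hence there is no yaw contribution.\<close>
  have gyro: "torque2 Jr \<Omega> w = vector
      [Jr * (\<Sum>i=1..4. (-1) ^ (i + 1) * \<Omega> $ 2 * w i),
       - (Jr * (\<Sum>i=1..4. (-1) ^ (i + 1) * \<Omega> $ 1 * w i)), 0]"
    unfolding torque2_def
    by (simp add: vec_eq_iff forall_3 diag_mult_nth cross3_def sum_distrib_left mult_ac
        flip: sum_negf)
  \<comment> \<open>The gyroscopic term of Euler's rigid body equations, with differences of the
    principal moments of inertia.\<close>
  have cross: "(diag J *v \<Omega>) \<times> \<Omega> = vector
      [(J $ 2 - J $ 3) * \<Omega> $ 2 * \<Omega> $ 3, (J $ 3 - J $ 1) * \<Omega> $ 1 * \<Omega> $ 3,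
       (J $ 1 - J $ 2) * \<Omega> $ 1 * \<Omega> $ 2]"
    by (simp add: vec_eq_iff forall_3 cross3_def diag_mult_nth algebra_simps)
  show ?thesis
    unfolding gyro cross torque_f_def torque1_def vec_eq_iff forall_3 diag_mult_nth div
    by (simp add: diag_mult_nth algebra_simps)
qed

theorem lemma3p1:
  fixes m g K\<^sub>r K\<^sub>d d Jr :: real
    and J C\<^sub>D C\<^sub>\<tau> :: "real^3"
    and I :: "real set"
    and \<omega> :: "real \<Rightarrow> nat \<Rightarrow> real"
    and b v \<Omega> :: "real \<Rightarrow> real^3"
    and R :: "real \<Rightarrow> real^3^3"
    and \<phi> \<theta> \<psi> :: "real \<Rightarrow> real"
  assumes "m > 0" and "\<And>k. J $ k > 0" and "g > 0" and "K\<^sub>r > 0" and "K\<^sub>d > 0" and "d > 0"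
    and "is_interval I" and "interior I \<noteq> {}"
    and "b differentiable_on I" and "R differentiable_on I"
    and "v differentiable_on I" and "\<Omega> differentiable_on I"
    and "\<phi> differentiable_on I" and "\<theta> differentiable_on I" and "\<psi> differentiable_on I"
    and "\<And>t. t \<in> I \<Longrightarrow> rotation_matrix (R t)"
    and "\<And>t. t \<in> I \<Longrightarrow> \<phi> t \<in> {-pi<..<pi}"
    and "\<And>t. t \<in> I \<Longrightarrow> \<theta> t \<in> {-pi/2<..<pi/2}"
    and "\<And>t. t \<in> I \<Longrightarrow> \<psi> t \<in> {-pi<..<pi}"
    and "\<And>t. t \<in> I \<Longrightarrow> R t = rot3 (\<psi> t) ** rot2 (\<theta> t) ** rot1 (\<phi> t)"
  shows
    "(\<forall>t\<in>I.
        dot I b t = R t *v v t \<and>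
        dot I R t = R t ** hat (\<Omega> t) \<and>
        m *\<^sub>R dot I v t
          = (m *\<^sub>R v t) \<times> \<Omega> t + force1 C\<^sub>D (v t) + force2 m g (R t) + force3 K\<^sub>r (\<omega> t) \<and>
        diag J *v dot I \<Omega> t
          = (diag J *v \<Omega> t) \<times> \<Omega> t + torque_f K\<^sub>r K\<^sub>d d (\<omega> t) + torque1 C\<^sub>\<tau> (\<Omega> t)
            + torque2 Jr (\<Omega> t) (\<omega> t))
     \<longleftrightarrow>
     (\<forall>t\<in>I.
        dot I (\<lambda>s. b s $ 1) t
          = v t $ 1 * (cos (\<psi> t) * cos (\<theta> t))
            + v t $ 2 * (cos (\<psi> t) * sin (\<theta> t) * sin (\<phi> t) - sin (\<psi> t) * cos (\<phi> t))
            + v t $ 3 * (cos (\<psi> t) * sin (\<theta> t) * cos (\<phi> t) + sin (\<psi> t) * sin (\<phi> t)) \<and>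
        dot I (\<lambda>s. b s $ 2) t
          = v t $ 1 * (sin (\<psi> t) * cos (\<theta> t))
            + v t $ 2 * (sin (\<psi> t) * sin (\<theta> t) * sin (\<phi> t) + cos (\<psi> t) * cos (\<phi> t))
            + v t $ 3 * (sin (\<psi> t) * sin (\<theta> t) * cos (\<phi> t) - cos (\<psi> t) * sin (\<phi> t)) \<and>
        dot I (\<lambda>s. b s $ 3) t
          = - v t $ 1 * sin (\<theta> t) + v t $ 2 * (cos (\<theta> t) * sin (\<phi> t))
            + v t $ 3 * (cos (\<theta> t) * cos (\<phi> t)) \<and>
        dot I \<phi> t
          = \<Omega> t $ 1 + \<Omega> t $ 2 * sin (\<phi> t) * tan (\<theta> t) + \<Omega> t $ 3 * cos (\<phi> t) * tan (\<theta> t) \<and>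
        dot I \<theta> t = \<Omega> t $ 2 * cos (\<phi> t) - \<Omega> t $ 3 * sin (\<phi> t) \<and>
        dot I \<psi> t
          = \<Omega> t $ 2 * (sin (\<phi> t) / cos (\<theta> t)) + \<Omega> t $ 3 * (cos (\<phi> t) / cos (\<theta> t)) \<and>
        dot I (\<lambda>s. v s $ 1) t
          = v t $ 2 * \<Omega> t $ 3 - v t $ 3 * \<Omega> t $ 2
            - 1 / m * v t $ 1 * \<bar>v t $ 1\<bar> * C\<^sub>D $ 1 + g * sin (\<theta> t) \<and>
        dot I (\<lambda>s. v s $ 2) t
          = v t $ 3 * \<Omega> t $ 1 - v t $ 1 * \<Omega> t $ 3
            - 1 / m * v t $ 2 * \<bar>v t $ 2\<bar> * C\<^sub>D $ 2 - g * cos (\<theta> t) * sin (\<phi> t) \<and>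
        dot I (\<lambda>s. v s $ 3) t
          = v t $ 1 * \<Omega> t $ 2 - v t $ 2 * \<Omega> t $ 1
            + 1 / m * ((\<Sum>i=1..4. thrust K\<^sub>r (\<omega> t) i) - v t $ 3 * \<bar>v t $ 3\<bar> * C\<^sub>D $ 3)
            - g * cos (\<theta> t) * cos (\<phi> t) \<and>
        dot I (\<lambda>s. \<Omega> s $ 1) t
          = 1 / J $ 1 * ((J $ 2 - J $ 3) * \<Omega> t $ 2 * \<Omega> t $ 3
              + Jr * (\<Sum>i=1..4. (-1) ^ (i + 1) * \<Omega> t $ 2 * \<omega> t i)
              + K\<^sub>r * d * ((\<omega> t 3)\<^sup>2 - (\<omega> t 1)\<^sup>2)
              - \<Omega> t $ 1 * \<bar>\<Omega> t $ 1\<bar> * C\<^sub>\<tau> $ 1) \<and>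
        dot I (\<lambda>s. \<Omega> s $ 2) t
          = 1 / J $ 2 * ((J $ 3 - J $ 1) * \<Omega> t $ 1 * \<Omega> t $ 3
              - Jr * (\<Sum>i=1..4. (-1) ^ (i + 1) * \<Omega> t $ 1 * \<omega> t i)
              + K\<^sub>r * d * ((\<omega> t 4)\<^sup>2 - (\<omega> t 2)\<^sup>2)
              - \<Omega> t $ 2 * \<bar>\<Omega> t $ 2\<bar> * C\<^sub>\<tau> $ 2) \<and>
        dot I (\<lambda>s. \<Omega> s $ 3) t
          = 1 / J $ 3 * ((J $ 1 - J $ 2) * \<Omega> t $ 1 * \<Omega> t $ 2
              + K\<^sub>d * (\<Sum>i=1..4. (-1) ^ (i + 1) * (\<omega> t i)\<^sup>2)
              - \<Omega> t $ 3 * \<bar>\<Omega> t $ 3\<bar> * C\<^sub>\<tau> $ 3))"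
    (is "(\<forall>t\<in>I. ?L t) \<longleftrightarrow> (\<forall>t\<in>I. ?R t)")
\<comment> \<open>The equivalence already holds at each single time, so no equation is ever
  integrated.\<close>
proof (intro ball_cong refl)
  fix t
  assume t: "t \<in> I"
  have nt: "at t within I \<noteq> bot"
    using assms(7,8) t by (rule at_within_interval_neq_bot)
  have diff: "f differentiable at t within I" if "f differentiable_on I"
    for f :: "real \<Rightarrow> 'a::real_normed_vector"
    using that t by (simp add: differentiable_on_def)
  note nth = vector_derivative_nth[OF diff[OF assms(9)] nt]
    vector_derivative_nth[OF diff[OF assms(11)] nt]
    vector_derivative_nth[OF diff[OF assms(12)] nt]
  have deriv: "(f has_real_derivative dot I f t) (at t within I)" if "f differentiable_on I" for f
    using diff[OF that] by (simp add: vector_derivative_works has_real_derivative_iff_has_vector_derivative)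
  \<comment> \<open>This follows from the parametrization alone, before either system of equations
    is assumed; it turns the attitude equation into a comparison of two hat matrices.\<close>
  have R': "dot I R t = R t ** hat (body_rate (\<phi> t) (\<theta> t) (dot I \<phi> t) (dot I \<theta> t) (dot I \<psi> t))"
    using diff[OF assms(10)] nt t assms(20) deriv[OF assms(13)] deriv[OF assms(14)] deriv[OF assms(15)]
    by (rule vector_derivative_rot_product)
  have "cos (\<theta> t) > 0"
    using assms(18)[OF t] by (intro cos_gt_zero_pi) auto
  then have cos: "cos (\<theta> t) \<noteq> 0"
    by simp
  note Rt = assms(20)[OF t]
  show "?L t \<longleftrightarrow> ?R t"
    \<comment> \<open>The attitude equation is rewritten while \<open>R t\<close> is still opaque,
      so that its orthogonality applies directly; only afterwards is \<open>R t\<close> expanded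
      into angles for the other equations.\<close>
    unfolding R' attitude_kinematics_iff[OF assms(16)[OF t] cos] nth
    unfolding Rt translation_kinematics_iff translation_dynamics_iff[OF assms(1)]
      rotation_dynamics_iff[OF assms(2)]
    by (simp only: conj_assoc)
qed

end
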